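(* Let $A \in \mathbb{R}^{n\times n}$, $b, x_0 \in \mathbb{R}^n$ with $r_0 = b - A x_0 \neq 0$, let $M : \mathbb{R}^n \to \mathbb{R}^n$ be an arbitrary (possibly nonlinear) operator, and let $1 \le m \le n$. Let $\widetilde{M} \in \mathbb{R}^{n\times n}$ be any matrix such that $A\widetilde{M}$ is diagonalizable, i.e. there is an invertible $X \in \mathbb{C}^{n\times n}$ with $$X^{-1} A \widetilde{M} X = \Lambda = \operatorname{diag}(\lambda_1,\ldots,\lambda_n).$$ Run FGMRES for $m$ steps, without restart and without breakdown, on the system $Ax=b$ from the initial guess $x_0$: once with the preconditioner $M$, producing $Z_m$ and the approximate solution $x_m$, and once with the fixed preconditioner matrix $\widetilde{M}$ (i.e. with the operator $v \mapsto \widetilde{M}v$), producing $\widetilde{Z}_m$. Let $Q_m$ and $\widetilde{Q}_m$ be the thin-Q factors of $A Z_m$ and $A\widetilde{Z}_m$, respectively. Then the residual $r_m = b - A x_m$ of the run with $M$ satisfies $$\| r_m \|_2 \le \kappa_2(X)\, \epsilon^{(m)}(\Lambda)\, \| r_0 \|_2 + \| Q_m Q_m^{\top} - \widetilde{Q}_m \widetilde{Q}_m^{\top} \|_2 \, \| r_0 \|_2,$$ where $$\epsilon^{(m)}(\Lambda) = \min_{p \in \mathbb{P}_m,\; p(0)=1}\ \max_{i=1,\ldots,n} |p(\lambda_i)| .$$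
   Context: FGMRES (flexible GMRES) without restart, run for $m$ steps with operator $M:\mathbb{R}^n\to\mathbb{R}^n$ (not necessarily linear), is the following procedure (exact arithmetic). Set $r_0 = b - A x_0$, $\beta = \|r_0\|_2$, $v_1 = r_0/\beta$. For $j = 1,\ldots,m$: compute $z_j = M(v_j)$ and $w = A z_j$; for $i=1,\ldots,j$ set $h_{ij} = w^\top v_i$ and replace $w$ by $w - h_{ij} v_i$; then set $h_{j+1,j} = \|w\|_2$ and $v_{j+1} = w/h_{j+1,j}$. All other $h_{ij}$ are zero. Let $Z_m = [z_1,\ldots,z_m] \in \mathbb{R}^{n\times m}$, $V_m = [v_1,\ldots,v_m]$, and $\overline{H}_m = [h_{ij}] \in \mathbb{R}^{(m+1)\times m}$. The approximate solution is $x_m = x_0 + Z_m y_m$, where $y_m$ minimizes $\|\beta e_1 - \overline{H}_m y\|_2$ over $y\in\mathbb{R}^m$; equivalently, $y_m$ minimizes $\|r_0 - A Z_m y\|_2$. "Without breakdown" means that $h_{j+1,j} \neq 0$ for every step $j \le m$ with $j < n$. (At step $j=n$, necessarily $w=0$ and $h_{n+1,n}=0$ because $v_1,\ldots,v_n$ is an orthonormal basis of $\mathbb{R}^n$; this is completion, not breakdown, and $v_{n+1}$ is not needed.) The thin-Q factor of a matrix $B$ is the factor $Q$ with orthonormal columns in a thin QR factorization of $B$, so that the columns of $Q$ form an orthonormal basis of the column space of $B$ and $QQ^\top$ is the orthogonal projector onto that column space. $\kappa_2(X) = \|X\|_2\|X^{-1}\|_2$ is the 2-norm condition number, and $\mathbb{P}_m$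 is the space of polynomials of degree at most $m$ (complex coefficients). *)

theory Defs
  imports "HOL-Analysis.Analysis" "HOL-Computational_Algebra.Polynomial"
begin

text \<open>
  Since the number of steps \<open>m\<close> varies independently of the index type, a matrix with \<open>m\<close> columns
  in \<open>real ^ 'n\<close> is represented by the family of its columns \<open>nat \<Rightarrow> real ^ 'n\<close>, of which only
  the members at the indices \<open>1, \<dots>, m\<close> matter.  Likewise a vector \<open>y\<close> with \<open>m\<close> entries is
  a function \<open>nat \<Rightarrow> real\<close>, read at \<open>1, \<dots>, m\<close>.
\<close>

definition lincomb :: "nat \<Rightarrow> (nat \<Rightarrow> real ^ 'n::finite) \<Rightarrow> (nat \<Rightarrow> real) \<Rightarrow> real ^ 'n" where
  "lincomb m Z y = (\<Sum>j=1..m. y j *\<^sub>R Z j)"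

text \<open>
  In the following, \<open>w i\<close> is the value of the work vector after \<open>i\<close> orthogonalization steps of
  the inner loop.  When \<open>h (j+1) j = 0\<close>, the vector \<open>v (j+1)\<close> is \<open>0\<close> by the convention
  \<open>inverse 0 = 0\<close>; in a run without breakdown this can only be \<open>v (n+1)\<close> for \<open>j = m = n\<close>,
  which is never used.
\<close>

definition fgmres_run ::
  "real ^ 'n ^ 'n \<Rightarrow> real ^ 'n \<Rightarrow> real ^ 'n \<Rightarrow> (real ^ 'n \<Rightarrow> real ^ 'n) \<Rightarrow> nat \<Rightarrow>
   (nat \<Rightarrow> real ^ 'n) \<Rightarrow> (nat \<Rightarrow> real ^ 'n) \<Rightarrow> (nat \<Rightarrow> nat \<Rightarrow> real) \<Rightarrow> bool" where
  "fgmres_run A b x0 M m v z h \<longleftrightarrow>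
     v 1 = (b - A *v x0) /\<^sub>R norm (b - A *v x0) \<and>
     (\<forall>j\<in>{1..m}.
        z j = M (v j) \<and>
        (\<exists>w. w 0 = A *v z j \<and>
             (\<forall>i\<in>{1..j}. h i j = w (i - 1) \<bullet> v i \<and> w i = w (i - 1) - h i j *\<^sub>R v i) \<and>
             h (j + 1) j = norm (w j) \<and>
             v (j + 1) = w j /\<^sub>R h (j + 1) j)) \<and>
     (\<forall>i j. j \<notin> {1..m} \<or> i \<notin> {1..j + 1} \<longrightarrow> h i j = 0)"

definition no_breakdown :: "nat \<Rightarrow> nat \<Rightarrow> (nat \<Rightarrow> nat \<Rightarrow> real) \<Rightarrow> bool" where
  "no_breakdown n m h \<longleftrightarrow> (\<forall>j\<in>{1..m}. j < n \<longrightarrow> h (j + 1) j \<noteq> 0)"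

definition hessenberg_residual :: "nat \<Rightarrow> real \<Rightarrow> (nat \<Rightarrow> nat \<Rightarrow> real) \<Rightarrow> (nat \<Rightarrow> real) \<Rightarrow> real" where
  "hessenberg_residual m \<beta> h y =
     L2_set (\<lambda>i. (if i = 1 then \<beta> else 0) - (\<Sum>j=1..m. h i j * y j)) {1..m + 1}"

text \<open>
  The minimizer is not unique if \<open>m = n\<close> and the Hessenberg matrix is singular; any one is allowed.
\<close>

definition fgmres_solution ::
  "real ^ 'n ^ 'n \<Rightarrow> real ^ 'n \<Rightarrow> real ^ 'n \<Rightarrow> nat \<Rightarrow>
   (nat \<Rightarrow> real ^ 'n) \<Rightarrow> (nat \<Rightarrow> nat \<Rightarrow> real) \<Rightarrow> real ^ 'n \<Rightarrow> bool" where
  "fgmres_solution A b x0 m z h x \<longleftrightarrow>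
     (\<exists>y. (\<forall>y'. hessenberg_residual m (norm (b - A *v x0)) h y
                \<le> hessenberg_residual m (norm (b - A *v x0)) h y') \<and>
          x = x0 + lincomb m z y)"

text \<open>
  Thin QR factorization \<open>B = Q R\<close> of a matrix \<open>B\<close> with \<open>m\<close> columns.  The columns of \<open>Q\<close> form an
  orthonormal basis of the column space of \<open>B\<close>, so their number \<open>r\<close> is the rank of \<open>B\<close>.
  In the full-rank case this is the usual factorization with \<open>r = m\<close>.
\<close>

definition thin_Q_factor ::
  "nat \<Rightarrow> (nat \<Rightarrow> real ^ 'n) \<Rightarrow> nat \<Rightarrow> (nat \<Rightarrow> real ^ 'n) \<Rightarrow> bool" where
  "thin_Q_factor m B r Q \<longleftrightarrow>
     (\<forall>k\<in>{1..r}. \<forall>l\<in>{1..r}. Q k \<bullet> Q l = (if k = l then 1 else 0)) \<and>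
     (\<exists>R. (\<forall>j\<in>{1..m}. B j = lincomb r Q (\<lambda>k. R k j)) \<and>
          (\<forall>k\<in>{1..r}. \<forall>j\<in>{1..m}. j < k \<longrightarrow> R k j = 0)) \<and>
     span (Q ` {1..r}) = span (B ` {1..m})"

text \<open>\<open>QQt r Q\<close> is the matrix product of \<open>Q\<close> with its transpose.\<close>

definition QQt :: "nat \<Rightarrow> (nat \<Rightarrow> real ^ 'n) \<Rightarrow> real ^ 'n ^ 'n" where
  "QQt r Q = (\<chi> i j. \<Sum>k=1..r. Q k $ i * Q k $ j)"

definition matrix_norm2 :: "'a::real_normed_field ^ 'n ^ 'm \<Rightarrow> real" where
  "matrix_norm2 X = onorm (\<lambda>x. X *v x)"

definition cond2 :: "complex ^ 'n ^ 'n \<Rightarrow> real" where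
  "cond2 X = matrix_norm2 X * matrix_norm2 (matrix_inv X)"

definition diag_matrix :: "complex ^ 'n \<Rightarrow> complex ^ 'n ^ 'n" where
  "diag_matrix \<Lambda> = (\<chi> i j. if i = j then \<Lambda> $ i else 0)"

definition residual_polys :: "nat \<Rightarrow> complex poly set" where
  "residual_polys m = {p. degree p \<le> m \<and> poly p 0 = 1}"

definition spectral_max :: "complex ^ 'n \<Rightarrow> complex poly \<Rightarrow> real" where
  "spectral_max \<Lambda> p = Max (range (\<lambda>i. cmod (poly p (\<Lambda> $ i))))"

definition eps_min :: "nat \<Rightarrow> complex ^ 'n \<Rightarrow> real" where
  "eps_min m \<Lambda> = (INF p\<in>residual_polys m. spectral_max \<Lambda> p)"

text \<open>The infimum is in fact a minimum.\<close>

lemma eps_min_attained: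
  fixes \<Lambda> :: "complex ^ 'n"
  shows "\<exists>p\<in>residual_polys m.
           spectral_max \<Lambda> p = eps_min m \<Lambda> \<and>
           (\<forall>q\<in>residual_polys m. spectral_max \<Lambda> p \<le> spectral_max \<Lambda> q)"
proof -
  define F :: "complex poly \<Rightarrow> complex ^ 'n" where "F p = (\<chi> i. poly p (\<Lambda> $ i))" for p
  define g :: "complex ^ 'n \<Rightarrow> real" where "g x = Max (range (\<lambda>i. cmod (x $ i)))" for x
  have gF: "spectral_max \<Lambda> p = g (F p)" for p
    by (simp add: spectral_max_def g_def F_def)
  have comp: "cmod (x $ i) \<le> g x" for x i
    by (simp add: g_def)
  have g_le: "g x \<le> c \<longleftrightarrow> (\<forall>i. cmod (x $ i) \<le> c)" for x c
    by (auto simp: g_def)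
  have lip1: "g x \<le> g y + norm (x - y)" for x y
    unfolding g_le
  proof
    fix i
    have "cmod (x $ i) \<le> cmod (y $ i) + cmod ((x - y) $ i)"
      by (metis add.commute diff_add_cancel norm_triangle_ineq vector_minus_component)
    then show "cmod (x $ i) \<le> g y + norm (x - y)"
      using comp[of y i] Finite_Cartesian_Product.norm_nth_le[of "x - y" i] by linarith
  qed
  have lip: "dist (g x) (g y) \<le> dist x y" for x y
    using lip1[of x y] lip1[of y x] by (simp add: dist_norm norm_minus_commute abs_le_iff)
  have contg: "continuous_on S g" for S
    unfolding continuous_on_iff using lip by (meson le_less_trans)
  have normg: "norm x \<le> real CARD('n) * g x" for x
  proof -
    have "norm x \<le> (\<Sum>i\<in>UNIV. cmod (x $ i))"
      by (simp add: norm_vec_def L2_set_le_sum)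
    also have "\<dots> \<le> (\<Sum>i\<in>(UNIV::'n set). g x)"
      by (intro sum_mono comp)
    finally show ?thesis by simp
  qed
  define S where "S = F ` residual_polys m"
  have Flin: "u *\<^sub>R F p + v *\<^sub>R F q = F (smult (of_real u) p + smult (of_real v) q)" for u v p q
    by (simp add: F_def vec_eq_iff) (simp add: scaleR_conv_of_real)
  have "affine S"
    unfolding affine_def S_def
  proof (intro ballI allI impI, elim imageE, hypsubst)
    fix u v :: real and p q
    assume "u + v = 1" and "p \<in> residual_polys m" and "q \<in> residual_polys m"
    then have "smult (of_real u) p + smult (of_real v) q \<in> residual_polys m"
      by (auto simp: residual_polys_def intro!: degree_add_le order_trans[OF degree_smult_le]
               simp flip: of_real_add)
    then show "u *\<^sub>R F p + v *\<^sub>R F q \<in> F ` residual_polys m"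
      unfolding Flin by blast
  qed
  then have clS: "closed S"
    by (metis affine_hull_eq closed_affine_hull)
  have one: "1 \<in> residual_polys m"
    by (simp add: residual_polys_def)
  define K where "K = S \<inter> cball 0 (real CARD('n) * g (F 1))"
  have "compact K"
    unfolding K_def using clS by (simp add: closed_Int_compact)
  moreover have "F 1 \<in> K"
    using one normg by (auto simp: K_def S_def)
  ultimately obtain x where x: "x \<in> K" "\<forall>y\<in>K. g x \<le> g y"
    using continuous_attains_inf[OF _ _ contg] by blast
  have min: "g x \<le> g y" if "y \<in> S" for y
  proof (cases "y \<in> K")
    case False
    then have "real CARD('n) * g (F 1) < norm y"
      using that by (auto simp: K_def)
    also have "\<dots> \<le> real CARD('n) * g y"
      by (rule normg)
    finally have "g (F 1) < g y"
      by simp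
    with x(2) \<open>F 1 \<in> K\<close> show ?thesis by fastforce
  qed (use x in blast)
  from x(1) obtain p where p: "p \<in> residual_polys m" "x = F p"
    by (auto simp: K_def S_def)
  have le: "\<forall>q\<in>residual_polys m. spectral_max \<Lambda> p \<le> spectral_max \<Lambda> q"
    using min p by (auto simp: gF S_def)
  have "eps_min m \<Lambda> = spectral_max \<Lambda> p"
    unfolding eps_min_def using le p(1) by (intro cInf_eq_minimum) auto
  with le p(1) show ?thesis by auto
qed

end

theory Submission
  imports Defs
begin

text \<open>
  The minimal residual property gives \<open>\<parallel>r\<^sub>m\<parallel> = min\<^sub>y \<parallel>r\<^sub>0 - A Z\<^sub>m y\<parallel> \<le> \<parallel>(I - Q Q\<^sup>T) r\<^sub>0\<parallel>\<close>, since
  \<open>Q Q\<^sup>T r\<^sub>0\<close> lies in the column space of \<open>A Z\<^sub>m\<close>; that the least-squares problem for the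
  Hessenberg matrix measures this norm is \<open>hessenberg_residual_eq_norm\<close>.  By the triangle
  inequality the right-hand side is at most
  \<open>\<parallel>(I - Q' Q'\<^sup>T) r\<^sub>0\<parallel> + \<parallel>Q Q\<^sup>T - Q' Q'\<^sup>T\<parallel> \<parallel>r\<^sub>0\<parallel>\<close>, where the dash refers to the run with the
  fixed matrix \<open>M'\<close>.

  Put \<open>B = A M'\<close>.  For the fixed preconditioner the column space of \<open>A Z'\<^sub>m\<close> contains
  \<open>B r\<^sub>0, \<dots>, B\<^sup>m r\<^sub>0\<close> (\<open>krylov_in_range\<close>), and \<open>I - Q' Q'\<^sup>T\<close> is the orthogonal projector onto
  its orthogonal complement, so \<open>\<parallel>(I - Q' Q'\<^sup>T) r\<^sub>0\<parallel> \<le> \<parallel>q(B) r\<^sub>0\<parallel>\<close> for every real polynomial \<open>q\<close> of degree at most \<open>m\<close>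
  with \<open>q(0) = 1\<close>.  If \<open>p\<close> is an optimal complex polynomial and \<open>q\<close> has the real parts of its
  coefficients, then \<open>q(B) r\<^sub>0\<close> is the real part of \<open>p(B) r\<^sub>0 = X p(\<Lambda>) X\<^sup>-\<^sup>1 r\<^sub>0\<close>, whose norm is at
  most \<open>\<kappa>\<^sub>2(X) max\<^sub>i |p(\<lambda>\<^sub>i)| \<parallel>r\<^sub>0\<parallel>\<close> (\<open>norm_real_matrix_poly_le\<close>).

  The vectors \<open>v i\<close> are pairwise orthogonal, each of norm 1 or 0, and row \<open>i\<close> of the
  Hessenberg matrix vanishes when \<open>v i = 0\<close>; this covers the vector \<open>v (n+1)\<close> of a completed run.
\<close>

section \<open>Matrix norms, linear combinations and orthogonal projectors\<close>

lemma norm_matrix_vector_le: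
  fixes X :: "'a::{real_normed_field,euclidean_space} ^ 'n ^ 'm"
  shows "norm (X *v x) \<le> matrix_norm2 X * norm x"
  unfolding matrix_norm2_def by (intro onorm matrix_vector_mul_bounded_linear)

lemma matrix_norm2_nonneg:
  fixes X :: "'a::{real_normed_field,euclidean_space} ^ 'n ^ 'm"
  shows "0 \<le> matrix_norm2 X"
  unfolding matrix_norm2_def by (intro onorm_pos_le matrix_vector_mul_bounded_linear)

lemma norm_scaleR_sgn: "norm x *\<^sub>R sgn x = x"
  for x :: "'a::real_normed_vector"
  by (cases "x = 0") (simp_all add: sgn_div_norm)

lemma matrix_inv_right: "invertible X \<Longrightarrow> X ** matrix_inv X = mat 1"
  unfolding invertible_def matrix_inv_def by (metis (mono_tags, lifting) someI_ex)

lemma range_lincomb: "range (lincomb m B) = span (B ` {1..m})"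
proof
  show "range (lincomb m B) \<subseteq> span (B ` {1..m})"
    unfolding lincomb_def by (intro image_subsetI span_sum span_scale span_base) simp
  show "span (B ` {1..m}) \<subseteq> range (lincomb m B)"
  proof (rule span_minimal)
    show "B ` {1..m} \<subseteq> range (lincomb m B)"
    proof clarify
      fix j assume "j \<in> {1..m}"
      then have "B j = lincomb m B (\<lambda>i. if i = j then 1 else 0)"
        by (simp add: lincomb_def if_distrib[of "\<lambda>a. a *\<^sub>R _"] sum.delta cong: if_cong)
      then show "B j \<in> range (lincomb m B)" by blast
    qed
    have "lincomb m B x + lincomb m B y = lincomb m B (\<lambda>j. x j + y j)" for x y
      by (simp add: lincomb_def scaleR_add_left sum.distrib)
    moreover have "c *\<^sub>R lincomb m B x = lincomb m B (\<lambda>j. c * x j)" for c x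
      by (simp add: lincomb_def scaleR_sum_right)
    moreover have "0 = lincomb m B (\<lambda>j. 0)"
      by (simp add: lincomb_def)
    ultimately show "subspace (range (lincomb m B))"
      unfolding subspace_def by (auto 0 3)
  qed
qed

lemma QQt_mult_vec: "QQt r Q *v x = (\<Sum>k=1..r. (Q k \<bullet> x) *\<^sub>R Q k)"
proof -
  have "(QQt r Q *v x) $ i = (\<Sum>k=1..r. (Q k \<bullet> x) *\<^sub>R Q k) $ i" for i
  proof -
    have "(QQt r Q *v x) $ i = (\<Sum>j\<in>UNIV. \<Sum>k=1..r. Q k $ i * Q k $ j * x $ j)"
      by (simp add: QQt_def matrix_vector_mult_def sum_distrib_right)
    also have "\<dots> = (\<Sum>k=1..r. \<Sum>j\<in>UNIV. Q k $ i * Q k $ j * x $ j)"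
      by (rule sum.swap)
    also have "\<dots> = (\<Sum>k=1..r. (Q k \<bullet> x) *\<^sub>R Q k) $ i"
      by (simp add: inner_vec_def sum_distrib_left sum_distrib_right mult_ac)
    finally show ?thesis .
  qed
  then show ?thesis by (simp add: vec_eq_iff)
qed

lemma QQt_mult_vec_in_span:
  assumes "thin_Q_factor m B r Q"
  shows "QQt r Q *v x \<in> span (B ` {1..m})"
proof -
  have "QQt r Q *v x \<in> span (Q ` {1..r})"
    unfolding QQt_mult_vec by (intro span_sum span_scale span_base) auto
  with assms show ?thesis by (simp add: thin_Q_factor_def)
qed

lemma thin_Q_projection_best:
  assumes Q: "thin_Q_factor m B r Q" and a: "a \<in> span (B ` {1..m})"
  shows "norm (x - QQt r Q *v x) \<le> norm (x - a)"
proof -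
  define e where "e = x - QQt r Q *v x"
  have on: "Q k \<bullet> Q l = (if k = l then 1 else 0)" if "k \<in> {1..r}" "l \<in> {1..r}" for k l
    using Q that by (simp add: thin_Q_factor_def)
  have "orthogonal e q" if "q \<in> Q ` {1..r}" for q
  proof -
    from that obtain l where l: "l \<in> {1..r}" "q = Q l" by auto
    have "(QQt r Q *v x) \<bullet> Q l = (\<Sum>k=1..r. (Q k \<bullet> x) * (Q k \<bullet> Q l))"
      by (simp add: QQt_mult_vec inner_sum_left)
    also have "\<dots> = (\<Sum>k=1..r. if k = l then Q k \<bullet> x else 0)"
      using l(1) by (intro sum.cong) (auto simp: on)
    also have "\<dots> = Q l \<bullet> x"
      using l(1) by simp
    finally show ?thesis
      by (simp add: e_def orthogonal_def l(2) inner_diff_left inner_commute[of x])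
  qed
  moreover have "QQt r Q *v x - a \<in> span (Q ` {1..r})"
    using QQt_mult_vec_in_span[OF Q] a Q
    by (simp add: thin_Q_factor_def span_diff)
  ultimately have "orthogonal e (QQt r Q *v x - a)"
    by (meson orthogonal_to_span)
  then have "(norm (e + (QQt r Q *v x - a)))\<^sup>2 = (norm e)\<^sup>2 + (norm (QQt r Q *v x - a))\<^sup>2"
    by (rule norm_add_Pythagorean)
  then have "(norm e)\<^sup>2 \<le> (norm (x - a))\<^sup>2"
    by (simp add: e_def)
  then show ?thesis
    by (simp add: e_def power2_le_iff_abs_le)
qed

section \<open>The Arnoldi relation\<close>

text \<open>
  In the two lemmas below, normalization is expressed by \<open>sgn\<close>, which maps \<open>0\<close> to \<open>0\<close> as the
  convention \<open>inverse 0 = 0\<close> does.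
\<close>

lemma fgmres_run_step:
  assumes run: "fgmres_run A b x0 M m v z h" and j: "j \<in> {1..m}"
  obtains w where "w 0 = A *v z j"
    and "\<And>i. i \<in> {1..j} \<Longrightarrow> h i j = w (i - 1) \<bullet> v i"
    and "\<And>i. i \<in> {1..j} \<Longrightarrow> w i = w (i - 1) - h i j *\<^sub>R v i"
    and "h (j + 1) j = norm (w j)" and "v (j + 1) = sgn (w j)"
proof -
  from run j obtain w where "w 0 = A *v z j"
    "\<forall>i\<in>{1..j}. h i j = w (i - 1) \<bullet> v i \<and> w i = w (i - 1) - h i j *\<^sub>R v i"
    "h (j + 1) j = norm (w j)" "v (j + 1) = w j /\<^sub>R h (j + 1) j"
    unfolding fgmres_run_def by blast
  then show ?thesis
    by (intro that[of w]) (auto simp: sgn_div_norm)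
qed

lemma fgmres_first: "fgmres_run A b x0 M m v z h \<Longrightarrow> v 1 = sgn (b - A *v x0)"
  by (simp add: fgmres_run_def sgn_div_norm)

lemma fgmres_norm_cases:
  assumes run: "fgmres_run A b x0 M m v z h" and i: "i \<in> {1..m+1}"
  shows "v i = 0 \<or> norm (v i) = 1"
proof (cases "i = 1")
  case True
  then show ?thesis using fgmres_first[OF run] by (simp add: norm_sgn sgn_zero_iff)
next
  case False
  then have j: "i - 1 \<in> {1..m}" "i = (i - 1) + 1"
    using i by auto
  obtain w where "v ((i - 1) + 1) = sgn (w (i - 1))"
    using fgmres_run_step[OF run j(1)] by metis
  then show ?thesis by (simp only: j(2)[symmetric]) (simp add: norm_sgn sgn_zero_iff)
qed

lemma fgmres_arnoldi:
  assumes run: "fgmres_run A b x0 M m v z h" and j: "j \<in> {1..m}"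
  shows "A *v z j = (\<Sum>i=1..j+1. h i j *\<^sub>R v i)"
proof -
  obtain w where w: "w 0 = A *v z j"
    "\<And>i. i \<in> {1..j} \<Longrightarrow> w i = w (i - 1) - h i j *\<^sub>R v i"
    "h (j + 1) j = norm (w j)" "v (j + 1) = sgn (w j)"
    using fgmres_run_step[OF run j] by metis
  have "i \<le> j \<Longrightarrow> w i = A *v z j - (\<Sum>k=1..i. h k j *\<^sub>R v k)" for i
  proof (induction i)
    case (Suc i)
    then show ?case using w(2)[of "Suc i"] by simp
  qed (simp add: w(1))
  from this[of j] have "A *v z j = (\<Sum>k=1..j. h k j *\<^sub>R v k) + w j"
    by simp
  moreover have "w j = h (j + 1) j *\<^sub>R v (j + 1)"
    by (simp only: w(3,4) norm_scaleR_sgn)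
  ultimately show ?thesis by simp
qed

lemma fgmres_orthogonal_less:
  assumes run: "fgmres_run A b x0 M m v z h"
  shows "k \<le> m + 1 \<Longrightarrow> 1 \<le> i \<Longrightarrow> i < k \<Longrightarrow> v k \<bullet> v i = 0"
proof (induction k arbitrary: i rule: less_induct)
  case (less k)
  define j where "j = k - 1"
  have j: "j \<in> {1..m}" "k = j + 1" using less.prems by (auto simp: j_def)
  obtain w where w: "\<And>i. i \<in> {1..j} \<Longrightarrow> h i j = w (i - 1) \<bullet> v i"
    "\<And>i. i \<in> {1..j} \<Longrightarrow> w i = w (i - 1) - h i j *\<^sub>R v i" "v (j + 1) = sgn (w j)"
    using fgmres_run_step[OF run j(1)] by metis
  \<comment> \<open>Each step of modified Gram-Schmidt keeps the work vector orthogonal to the earlier \<open>v l\<close>.\<close>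
  have "i \<le> j \<Longrightarrow> \<forall>l\<in>{1..i}. w i \<bullet> v l = 0" for i
  proof (induction i)
    case (Suc i)
    then have h: "h (Suc i) j = w i \<bullet> v (Suc i)"
      and wS: "w (Suc i) = w i - h (Suc i) j *\<^sub>R v (Suc i)"
      using w(1,2)[of "Suc i"] by simp_all
    show ?case
    proof
      fix l assume l: "l \<in> {1..Suc i}"
      show "w (Suc i) \<bullet> v l = 0"
      proof (cases "l = Suc i")
        case True
        have "v (Suc i) = 0 \<or> norm (v (Suc i)) = 1"
          using fgmres_norm_cases[OF run, of "Suc i"] Suc.prems j by simp
        then have "h (Suc i) j * (v (Suc i) \<bullet> v (Suc i)) = h (Suc i) j"
          using h by (auto simp: dot_square_norm)
        then show ?thesis
          using True h wS by (simp add: inner_diff_left)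
      next
        case False
        then have "v (Suc i) \<bullet> v l = 0"
          using less.IH[of "Suc i" l] l Suc.prems j by simp
        then show ?thesis
          using False l Suc wS by (simp add: inner_diff_left)
      qed
    qed
  qed simp
  from this[of j] have "w j \<bullet> v i = 0"
    using less.prems j by simp
  then show ?case using w(3) j by (simp add: sgn_div_norm)
qed

lemma fgmres_orthogonal:
  assumes "fgmres_run A b x0 M m v z h" "i \<in> {1..m+1}" "k \<in> {1..m+1}" "i \<noteq> k"
  shows "v i \<bullet> v k = 0"
  using fgmres_orthogonal_less[OF assms(1), of i k] fgmres_orthogonal_less[OF assms(1), of k i] assms
  by (cases "i < k") (auto simp: inner_commute)

text \<open>
  A vector \<open>v i\<close> that is zero by the convention \<open>inverse 0 = 0\<close> belongs to a zero row of the
  Hessenberg matrix.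
\<close>

lemma fgmres_zero_row:
  assumes run: "fgmres_run A b x0 M m v z h" and "v i = 0"
  shows "h i j = 0"
proof (cases "j \<in> {1..m} \<and> i \<in> {1..j+1}")
  case True
  obtain w where w: "\<And>i. i \<in> {1..j} \<Longrightarrow> h i j = w (i - 1) \<bullet> v i"
    "h (j + 1) j = norm (w j)" "v (j + 1) = sgn (w j)"
    using fgmres_run_step[OF run] True by metis
  show ?thesis
  proof (cases "i = j + 1")
    case True
    then show ?thesis using w(2,3) \<open>v i = 0\<close> by (simp add: sgn_zero_iff)
  next
    case False
    then show ?thesis using w(1)[of i] True \<open>v i = 0\<close> by simp
  qed
qed (use run in \<open>auto simp: fgmres_run_def\<close>)

lemma hessenberg_residual_eq_norm:
  assumes run: "fgmres_run A b x0 M m v z h" and r0: "b - A *v x0 \<noteq> 0"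
  shows "hessenberg_residual m (norm (b - A *v x0)) h y
       = norm (b - A *v x0 - lincomb m (\<lambda>j. A *v z j) y)"
proof -
  define c where "c i = (if i = 1 then norm (b - A *v x0) else 0) - (\<Sum>j=1..m. h i j * y j)" for i
  have az: "A *v z j = (\<Sum>i=1..m+1. h i j *\<^sub>R v i)" if "j \<in> {1..m}" for j
    unfolding fgmres_arnoldi[OF run that]
    using that run by (intro sum.mono_neutral_left) (auto simp: fgmres_run_def)
  have "lincomb m (\<lambda>j. A *v z j) y = (\<Sum>j=1..m. \<Sum>i=1..m+1. (h i j * y j) *\<^sub>R v i)"
    unfolding lincomb_def
    by (intro sum.cong refl) (simp only: az scaleR_sum_right scaleR_scaleR mult.commute)
  also have "\<dots> = (\<Sum>i=1..m+1. (\<Sum>j=1..m. h i j * y j) *\<^sub>R v i)"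
    by (subst sum.swap) (simp only: scaleR_sum_left)
  finally have lc: "lincomb m (\<lambda>j. A *v z j) y = (\<Sum>i=1..m+1. (\<Sum>j=1..m. h i j * y j) *\<^sub>R v i)" .
  have "b - A *v x0 = norm (b - A *v x0) *\<^sub>R v 1"
    by (simp only: fgmres_first[OF run] norm_scaleR_sgn)
  also have "\<dots> = (\<Sum>i=1..m+1. (if i = 1 then norm (b - A *v x0) else 0) *\<^sub>R v i)"
    by (simp add: if_distrib[of "\<lambda>a. a *\<^sub>R _"] sum.delta cong: if_cong)
  finally have "b - A *v x0 - lincomb m (\<lambda>j. A *v z j) y = (\<Sum>i=1..m+1. c i *\<^sub>R v i)"
    unfolding lc c_def scaleR_diff_left sum_subtractf by simp
  moreover have "(norm (\<Sum>i=1..m+1. c i *\<^sub>R v i))\<^sup>2 = (\<Sum>i=1..m+1. (norm (c i *\<^sub>R v i))\<^sup>2)"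
    using fgmres_orthogonal[OF run]
    by (intro norm_sum_Pythagorean) (auto simp: pairwise_def orthogonal_def)
  moreover have "(norm (c i *\<^sub>R v i))\<^sup>2 = (c i)\<^sup>2" if i: "i \<in> {1..m+1}" for i
  proof (cases "v i = 0")
    case True
    then have "i \<noteq> 1"
      using r0 fgmres_first[OF run] by (auto simp: sgn_zero_iff)
    then have "c i = 0"
      using fgmres_zero_row[OF run True] by (simp add: c_def)
    then show ?thesis by simp
  next
    case False
    then show ?thesis
      using fgmres_norm_cases[OF run i] by simp
  qed
  ultimately have "(norm (b - A *v x0 - lincomb m (\<lambda>j. A *v z j) y))\<^sup>2 = (\<Sum>i=1..m+1. (c i)\<^sup>2)"
    by simp
  then have "L2_set c {1..m+1} = norm (b - A *v x0 - lincomb m (\<lambda>j. A *v z j) y)"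
    unfolding L2_set_def by (metis norm_ge_zero real_sqrt_abs abs_of_nonneg)
  then show ?thesis
    by (simp add: hessenberg_residual_def c_def[abs_def])
qed

lemma matrix_mult_lincomb: "A *v lincomb m z y = lincomb m (\<lambda>j. A *v z j) y"
  by (simp add: lincomb_def linear_sum[OF matrix_vector_mul_linear]
        linear_scale[OF matrix_vector_mul_linear])

lemma fgmres_minimal_residual:
  assumes run: "fgmres_run A b x0 M m v z h" and r0: "b - A *v x0 \<noteq> 0"
    and sol: "fgmres_solution A b x0 m z h xm"
    and a: "a \<in> span ((\<lambda>j. A *v z j) ` {1..m})"
  shows "norm (b - A *v xm) \<le> norm (b - A *v x0 - a)"
proof -
  obtain y where y: "xm = x0 + lincomb m z y"
    "\<And>y'. hessenberg_residual m (norm (b - A *v x0)) h y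
        \<le> hessenberg_residual m (norm (b - A *v x0)) h y'"
    using sol unfolding fgmres_solution_def by blast
  obtain y' where y': "a = lincomb m (\<lambda>j. A *v z j) y'"
    using a unfolding range_lincomb[symmetric] by blast
  have "b - A *v xm = b - A *v x0 - lincomb m (\<lambda>j. A *v z j) y"
    by (simp add: y(1) matrix_vector_right_distrib matrix_mult_lincomb)
  then show ?thesis
    using y(2)[of y'] by (simp only: hessenberg_residual_eq_norm[OF run r0] y')
qed

section \<open>Krylov spaces and polynomials in a diagonalizable matrix\<close>

text \<open>
  The power \<open>B\<^sup>k r\<^sub>0\<close> lies in the span of \<open>v 1, \<dots>, v (k+1)\<close> by the Arnoldi relation, and \<open>B\<close> maps
  each \<open>v j\<close> with \<open>j \<le> m\<close> to \<open>A z j\<close>.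
\<close>

lemma krylov_in_range:
  fixes A Mt :: "real ^ 'n ^ 'n"
  assumes run: "fgmres_run A b x0 (\<lambda>u. Mt *v u) m v z h" and "k < m"
  shows "(((*v) (A ** Mt)) ^^ Suc k) (b - A *v x0) \<in> span ((\<lambda>j. A *v z j) ` {1..m})"
proof -
  let ?B = "A ** Mt"
  have Bv: "?B *v v j = A *v z j" if "j \<in> {1..m}" for j
    using run that by (simp add: fgmres_run_def matrix_vector_mul_assoc)
  have kry: "k \<le> m \<Longrightarrow> (((*v) ?B) ^^ k) (b - A *v x0) \<in> span (v ` {1..k+1})" for k
  proof (induction k)
    case 0
    have "b - A *v x0 = norm (b - A *v x0) *\<^sub>R v 1"
      by (simp only: fgmres_first[OF run] norm_scaleR_sgn)
    moreover have "norm (b - A *v x0) *\<^sub>R v 1 \<in> span {v 1}"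
      by (intro span_scale span_base) simp
    ultimately show ?case by simp
  next
    case (Suc k)
    then have "?B *v (((*v) ?B) ^^ k) (b - A *v x0) \<in> (*v) ?B ` span (v ` {1..k+1})"
      by simp
    also have "\<dots> = span ((*v) ?B ` v ` {1..k+1})"
      by (rule linear_span_image[symmetric]) simp
    also have "\<dots> \<subseteq> span (v ` {1..Suc k + 1})"
    proof (intro span_minimal subspace_span, clarify)
      fix j assume "j \<in> {1..k+1}"
      then have "j \<in> {1..m}" and "j \<le> k + 1" using Suc.prems by auto
      then have "?B *v v j = (\<Sum>i=1..j+1. h i j *\<^sub>R v i)"
        using Bv fgmres_arnoldi[OF run] by simp
      moreover have "(\<Sum>i=1..j+1. h i j *\<^sub>R v i) \<in> span (v ` {1..Suc k + 1})"
        using \<open>j \<le> k + 1\<close> by (intro span_sum span_scale span_base) auto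
      ultimately show "?B *v v j \<in> span (v ` {1..Suc k + 1})" by simp
    qed
    finally show ?case by simp
  qed
  have "?B *v (((*v) ?B) ^^ k) (b - A *v x0) \<in> (*v) ?B ` span (v ` {1..k+1})"
    using kry[of k] \<open>k < m\<close> by simp
  also have "\<dots> = span ((*v) ?B ` v ` {1..k+1})"
    by (rule linear_span_image[symmetric]) simp
  also have "\<dots> \<subseteq> span ((\<lambda>j. A *v z j) ` {1..m})"
    using \<open>k < m\<close> by (intro span_mono) (auto simp: Bv)
  finally show ?thesis by simp
qed

lemma norm_componentwise_mult_le:
  fixes c y :: "complex ^ 'n"
  assumes "\<And>i. cmod (c $ i) \<le> K"
  shows "norm (\<chi> i. c $ i * y $ i) \<le> K * norm y"
proof -
  have "0 \<le> K" using assms[of undefined] norm_ge_zero order_trans by blast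
  have "norm (\<chi> i. c $ i * y $ i) \<le> L2_set (\<lambda>i. K * norm (y $ i)) UNIV"
    unfolding norm_vec_def
    by (intro L2_set_mono) (simp_all add: norm_mult mult_right_mono assms)
  also have "\<dots> = K * norm y"
    using \<open>0 \<le> K\<close> by (simp add: norm_vec_def L2_set_right_distrib)
  finally show ?thesis .
qed

lemma diag_matrix_mult_vec: "diag_matrix \<Lambda> *v u = (\<chi> i. \<Lambda> $ i * u $ i)"
  by (simp add: vec_eq_iff matrix_vector_mult_def diag_matrix_def if_distrib[of "\<lambda>a. a * _"]
      cong: if_cong)

text \<open>
  This is \<open>B\<^sup>k x = X \<Lambda>\<^sup>k X\<^sup>-\<^sup>1 x\<close>, with the power of \<open>B\<close> taken as an iterated real map and only
  the result embedded into the complex space.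
\<close>

lemma diagonalized_power:
  fixes B :: "real ^ 'n ^ 'n" and X :: "complex ^ 'n ^ 'n"
  assumes X: "invertible X"
    and diag: "matrix_inv X ** map_matrix complex_of_real B ** X = diag_matrix \<Lambda>"
  shows "(\<chi> i. complex_of_real ((((*v) B) ^^ k) x $ i))
       = X *v (\<chi> i. \<Lambda> $ i ^ k * (matrix_inv X *v (\<chi> i. complex_of_real (x $ i))) $ i)"
proof (induction k)
  case 0
  then show ?case
    by (simp add: matrix_vector_mul_assoc matrix_inv_right[OF X] vec_lambda_eta)
next
  case (Suc k)
  let ?B = "map_matrix complex_of_real B"
  let ?y = "matrix_inv X *v (\<chi> i. complex_of_real (x $ i))"
  have BX: "?B ** X = X ** diag_matrix \<Lambda>"
    unfolding diag[symmetric]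
    by (simp add: matrix_mul_assoc matrix_inv_right[OF X])
  have "(\<chi> i. complex_of_real ((B *v u) $ i)) = ?B *v (\<chi> i. complex_of_real (u $ i))" for u
    by (simp add: vec_eq_iff matrix_vector_mult_def map_matrix_def)
  then have "(\<chi> i. complex_of_real ((((*v) B) ^^ Suc k) x $ i))
      = ?B *v (X *v (\<chi> i. \<Lambda> $ i ^ k * ?y $ i))"
    by (simp add: Suc.IH)
  also have "\<dots> = X *v (diag_matrix \<Lambda> *v (\<chi> i. \<Lambda> $ i ^ k * ?y $ i))"
    by (simp add: matrix_vector_mul_assoc BX)
  also have "diag_matrix \<Lambda> *v (\<chi> i. \<Lambda> $ i ^ k * ?y $ i) = (\<chi> i. \<Lambda> $ i ^ Suc k * ?y $ i)"
    by (simp add: diag_matrix_mult_vec mult.assoc)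
  finally show ?case .
qed

text \<open>
  Taking real parts of the coefficients costs nothing: for real \<open>B\<close> and \<open>x\<close> the left-hand side
  is the norm of the real part of \<open>p(B) x\<close>.
\<close>

lemma norm_real_matrix_poly_le:
  fixes B :: "real ^ 'n ^ 'n" and X :: "complex ^ 'n ^ 'n" and p :: "complex poly"
  assumes X: "invertible X"
    and diag: "matrix_inv X ** map_matrix complex_of_real B ** X = diag_matrix \<Lambda>"
    and deg: "degree p \<le> m"
  shows "norm (\<Sum>k\<le>m. Re (coeff p k) *\<^sub>R (((*v) B) ^^ k) x) \<le> cond2 X * spectral_max \<Lambda> p * norm x"
proof -
  define xc :: "complex ^ 'n" where "xc = (\<chi> i. complex_of_real (x $ i))"
  define y where "y = matrix_inv X *v xc"
  define U where "U = X *v (\<chi> i. (\<chi> i. poly p (\<Lambda> $ i)) $ i * y $ i)"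
  have pw: "complex_of_real ((((*v) B) ^^ k) x $ i) = (\<Sum>j\<in>UNIV. X $ i $ j * (\<Lambda> $ j ^ k * y $ j))"
    for k i
    using arg_cong[OF diagonalized_power[OF X diag, of k x], of "\<lambda>u. u $ i"]
    by (simp add: matrix_vector_mult_def[of X] y_def xc_def)
  have pl: "poly p c = (\<Sum>k\<le>m. coeff p k * c ^ k)" for c
    unfolding poly_altdef using deg
    by (intro sum.mono_neutral_left) (auto simp: coeff_eq_0)
  have U: "U $ i = (\<Sum>k\<le>m. coeff p k * complex_of_real ((((*v) B) ^^ k) x $ i))" for i
  proof -
    have "U $ i = (\<Sum>j\<in>UNIV. \<Sum>k\<le>m. coeff p k * (X $ i $ j * (\<Lambda> $ j ^ k * y $ j)))"
      by (simp add: U_def matrix_vector_mult_def pl sum_distrib_left sum_distrib_right mult_ac)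
    also have "\<dots> = (\<Sum>k\<le>m. coeff p k * complex_of_real ((((*v) B) ^^ k) x $ i))"
      by (subst sum.swap) (simp add: pw sum_distrib_left)
    finally show ?thesis .
  qed
  have "norm (\<Sum>k\<le>m. Re (coeff p k) *\<^sub>R (((*v) B) ^^ k) x) \<le> norm U"
  proof (rule norm_le_componentwise_cart)
    fix i
    have "(\<Sum>k\<le>m. Re (coeff p k) *\<^sub>R (((*v) B) ^^ k) x) $ i = Re (U $ i)"
      by (simp add: U)
    then show "norm ((\<Sum>k\<le>m. Re (coeff p k) *\<^sub>R (((*v) B) ^^ k) x) $ i) \<le> norm (U $ i)"
      by (simp only: real_norm_def abs_Re_le_cmod)
  qed
  also have "\<dots> \<le> matrix_norm2 X * (spectral_max \<Lambda> p * norm y)"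
    unfolding U_def
    by (intro order_trans[OF norm_matrix_vector_le] mult_left_mono norm_componentwise_mult_le
          matrix_norm2_nonneg) (simp add: spectral_max_def)
  also have "\<dots> \<le> matrix_norm2 X * (spectral_max \<Lambda> p * (matrix_norm2 (matrix_inv X) * norm xc))"
  proof -
    have "cmod (poly p (\<Lambda> $ undefined)) \<le> spectral_max \<Lambda> p"
      by (simp add: spectral_max_def)
    then have "0 \<le> spectral_max \<Lambda> p"
      using norm_ge_zero order_trans by blast
    then show ?thesis
      unfolding y_def by (intro mult_left_mono norm_matrix_vector_le matrix_norm2_nonneg)
  qed
  also have "norm xc = norm x"
    by (simp add: xc_def norm_vec_def)
  finally show ?thesis
    by (simp add: cond2_def mult_ac)
qed

section \<open>The convergence bound\<close>

theorem theorem1: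
  fixes A Mt :: "real ^ 'n ^ 'n" and b x0 xm :: "real ^ 'n"
    and M :: "real ^ 'n \<Rightarrow> real ^ 'n" and m r rt :: nat
    and X :: "complex ^ 'n ^ 'n" and \<Lambda> :: "complex ^ 'n"
    and v z vt zt Q Qt :: "nat \<Rightarrow> real ^ 'n" and h ht :: "nat \<Rightarrow> nat \<Rightarrow> real"
  assumes r0: "b - A *v x0 \<noteq> 0"
    and m: "1 \<le> m" "m \<le> CARD('n)"
    and X: "invertible X"
    and diag: "matrix_inv X ** map_matrix complex_of_real (A ** Mt) ** X = diag_matrix \<Lambda>"
    and run: "fgmres_run A b x0 M m v z h" "no_breakdown CARD('n) m h"
    and sol: "fgmres_solution A b x0 m z h xm"
    and run_t: "fgmres_run A b x0 (\<lambda>u. Mt *v u) m vt zt ht" "no_breakdown CARD('n) m ht"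
    and Q: "thin_Q_factor m (\<lambda>j. A *v z j) r Q"
    and Qt: "thin_Q_factor m (\<lambda>j. A *v zt j) rt Qt"
  shows "norm (b - A *v xm)
       \<le> cond2 X * eps_min m \<Lambda> * norm (b - A *v x0)
         + matrix_norm2 (QQt r Q - QQt rt Qt) * norm (b - A *v x0)"
proof -
  let ?r = "b - A *v x0"
  let ?B = "A ** Mt"
  obtain p where p: "degree p \<le> m" "poly p 0 = 1" "spectral_max \<Lambda> p = eps_min m \<Lambda>"
    using eps_min_attained[of m \<Lambda>] by (auto simp: residual_polys_def)
  let ?q = "\<Sum>k\<le>m. Re (coeff p k) *\<^sub>R (((*v) ?B) ^^ k) ?r"
  define a where "a = - (\<Sum>k<m. Re (coeff p (Suc k)) *\<^sub>R (((*v) ?B) ^^ Suc k) ?r)"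
  have "coeff p 0 = 1"
    using p(2) by (simp add: poly_0_coeff_0)
  then have "?q = ?r - a"
    unfolding a_def by (subst sum.atMost_shift) simp
  have "a \<in> span ((\<lambda>j. A *v zt j) ` {1..m})"
    unfolding a_def
    by (intro span_neg span_sum span_scale krylov_in_range[OF run_t(1)]) simp
  then have "norm (?r - QQt rt Qt *v ?r) \<le> norm ?q"
    unfolding \<open>?q = ?r - a\<close> by (rule thin_Q_projection_best[OF Qt])
  also have "\<dots> \<le> cond2 X * eps_min m \<Lambda> * norm ?r"
    using norm_real_matrix_poly_le[OF X diag p(1)] p(3) by simp
  finally have fixed: "norm (?r - QQt rt Qt *v ?r) \<le> cond2 X * eps_min m \<Lambda> * norm ?r" .
  have "norm (b - A *v xm) \<le> norm (?r - QQt r Q *v ?r)"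
    by (rule fgmres_minimal_residual[OF run(1) r0 sol QQt_mult_vec_in_span[OF Q]])
  also have "?r - QQt r Q *v ?r = (?r - QQt rt Qt *v ?r) - (QQt r Q - QQt rt Qt) *v ?r"
    by (simp add: matrix_vector_mult_diff_rdistrib)
  also have "norm \<dots> \<le> norm (?r - QQt rt Qt *v ?r) + norm ((QQt r Q - QQt rt Qt) *v ?r)"
    by (rule norm_triangle_ineq4)
  also have "\<dots> \<le> cond2 X * eps_min m \<Lambda> * norm ?r
      + matrix_norm2 (QQt r Q - QQt rt Qt) * norm ?r"
    by (intro add_mono fixed norm_matrix_vector_le)
  finally show ?thesis .
qed

end
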